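(* Let $k,m\ge 1$ be integers, and let $\alpha_1,\dots,\alpha_k\in\mathbb{C}$ and $\beta_1,\dots,\beta_k\in\mathbb{C}$ satisfy $\alpha_i+\beta_i\neq 0$, $|\beta_i|<1$ and $\beta_i\neq 0$ for $i=1,\dots,k$. Let $\tilde A^{(k)}\in\mathbb{C}^{km\times km}$, $\tilde B^{(k)}\in\mathbb{C}^{km\times m}$ and $X_{\mathrm{fadi}}^{(k)}\in\mathbb{C}^{km\times km}$ be the matrices built from these shifts as described in the context, and let $\tilde P^{(k)}$ be the controllability Gramian of $(\tilde A^{(k)},\tilde B^{(k)})$, i.e. the unique solution of $$\tilde A^{(k)}\tilde P^{(k)}(\tilde A^{(k)})^*-\tilde P^{(k)}+\tilde B^{(k)}(\tilde B^{(k)})^*=0.$$ Define upper-triangular matrices $T^{(j)}\in\mathbb{C}^{j\times j}$, $j=1,\dots,k$, recursively by $T^{(1)}=t_2^{(1)}$ and, for $j\ge 2$, $$T^{(j)}=\begin{bmatrix} T^{(j-1)} & t_1^{(j)}\\ 0 & t_2^{(j)}\end{bmatrix},$$ where $t_1^{(j)}\in\mathbb{C}^{j-1}$ has entries, computed successively for $i=1,\dots,j-1$, $$\left[t_1^{(j)}\right]_i=\frac{1+\displaystyle\sum_{r=i}^{j-1}\overline{(\alpha_r+\beta_r)}\,T^{(j-1)}_{ir}-\displaystyle\sum_{r=1}^{i-1}\left(\frac{1}{\beta_r}-\overline{\beta_r}\right)\left[t_1^{(j)}\right]_r}{\frac{1}{\beta_i}-\overline{\beta_j}},$$ and (empty sums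 being zero) $$t_2^{(j)}=\frac{1-\displaystyle\sum_{r=1}^{j-1}\left(\frac{1}{\beta_r}-\overline{\beta_r}\right)\left[t_1^{(j)}\right]_r}{\frac{1}{\beta_j}-\overline{\beta_j}}.$$ Put $\hat T^{(k)}=T^{(k)}\otimes I_m$, $$Z^{(k)}=\operatorname{diag}\left(\sqrt{\frac{1-|\beta_1|^2}{|\beta_1|^2}},\ \ldots,\ \sqrt{\frac{1-|\beta_k|^2}{\prod_{j=1}^{k}|\beta_j|^2}}\right)\otimes I_m$$ (the $i$-th diagonal entry being $\sqrt{(1-|\beta_i|^2)/\prod_{j=1}^{i}|\beta_j|^2}$), and $$\tilde Z^{(k)}=X_{\mathrm{fadi}}^{(k)}(\hat T^{(k)})^*Z^{(k)}.$$ Then $$\tilde P^{(k)}=\tilde Z^{(k)}(\tilde Z^{(k)})^*.$$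
   Context: Here $^*$ denotes conjugate transpose, $\otimes$ the Kronecker product, $I_m$ the $m\times m$ identity, and $\mathbf 1_j$ the $j\times 1$ vector of ones. Given shifts $\alpha_i,\beta_i$, define scalar-block matrices recursively by $a^{(1)}=\beta_1$, $b^{(1)}=\alpha_1+\beta_1$, and for $j\ge 2$ $$a^{(j)}=\begin{bmatrix} a^{(j-1)} & 0\\ (\alpha_j+\beta_j)\mathbf 1_{j-1}^\top & \beta_j\end{bmatrix}\in\mathbb{C}^{j\times j},\qquad b^{(j)}=\begin{bmatrix} b^{(j-1)}\\ \alpha_j+\beta_j\end{bmatrix}\in\mathbb{C}^{j}.$$ Then $\tilde A^{(k)}=a^{(k)}\otimes I_m$ and $\tilde B^{(k)}=b^{(k)}\otimes I_m$. Equivalently, $a^{(k)}$ is lower triangular with $(i,i)$ entry $\beta_i$ and $(i,\ell)$ entry $\alpha_i+\beta_i$ for $\ell<i$, and $b^{(k)}=(\alpha_1+\beta_1,\dots,\alpha_k+\beta_k)^\top$. Moreover $$X_{\mathrm{fadi}}^{(k)}=\operatorname{diag}\big(-(\alpha_1+\beta_1),\dots,-(\alpha_k+\beta_k)\big)\otimes I_m.$$ The Stein equation for $\tilde P^{(k)}$ has a unique solution because the eigenvalues $\beta_i$ of $\tilde A^{(k)}$ satisfy $|\beta_i|<1$. *)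

theory Defs
  imports Complex_Main "Jordan_Normal_Form.Schur_Decomposition"
begin

text \<open>
  Matrices are those of \<open>Jordan_Normal_Form\<close>, whose entries are indexed from 0. Shifts are
  functions \<open>nat \<Rightarrow> complex\<close> of which only the values at \<open>1, \<dots>, k\<close> matter. Hence the entry in
  row \<open>i\<close>, column \<open>l\<close> (counted from 1) of \<open>M\<close> is \<open>M $$ (i - 1, l - 1)\<close>. The conjugate transpose
  is \<open>mat_adjoint\<close>. The families indexed by \<open>j \<ge> 1\<close> get the empty matrix as a dummy value at 0.
\<close>

definition kronecker :: "complex mat \<Rightarrow> complex mat \<Rightarrow> complex mat" (infixl \<open>\<otimes>\<^sub>k\<close> 70) where
  "A \<otimes>\<^sub>k B = mat (dim_row A * dim_row B) (dim_col A * dim_col B)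
     (\<lambda>(i, j). A $$ (i div dim_row B, j div dim_col B) * B $$ (i mod dim_row B, j mod dim_col B))"

definition scalar_mat :: "complex \<Rightarrow> complex mat" where
  "scalar_mat c = mat 1 1 (\<lambda>_. c)"

definition ones_col :: "nat \<Rightarrow> complex mat" where
  "ones_col j = mat j 1 (\<lambda>_. 1)"

fun a_block :: "(nat \<Rightarrow> complex) \<Rightarrow> (nat \<Rightarrow> complex) \<Rightarrow> nat \<Rightarrow> complex mat" where
  "a_block \<alpha> \<beta> 0 = 0\<^sub>m 0 0"
| "a_block \<alpha> \<beta> (Suc 0) = scalar_mat (\<beta> 1)"
| "a_block \<alpha> \<beta> (Suc (Suc n)) = (let j = Suc (Suc n) in
     four_block_mat (a_block \<alpha> \<beta> (Suc n)) (0\<^sub>m (j - 1) 1)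
       ((\<alpha> j + \<beta> j) \<cdot>\<^sub>m transpose_mat (ones_col (j - 1))) (scalar_mat (\<beta> j)))"

fun b_block :: "(nat \<Rightarrow> complex) \<Rightarrow> (nat \<Rightarrow> complex) \<Rightarrow> nat \<Rightarrow> complex mat" where
  "b_block \<alpha> \<beta> 0 = 0\<^sub>m 0 1"
| "b_block \<alpha> \<beta> (Suc 0) = scalar_mat (\<alpha> 1 + \<beta> 1)"
| "b_block \<alpha> \<beta> (Suc (Suc n)) = (let j = Suc (Suc n) in
     b_block \<alpha> \<beta> (Suc n) @\<^sub>r scalar_mat (\<alpha> j + \<beta> j))"

definition A_tilde :: "nat \<Rightarrow> (nat \<Rightarrow> complex) \<Rightarrow> (nat \<Rightarrow> complex) \<Rightarrow> nat \<Rightarrow> complex mat" where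
  "A_tilde m \<alpha> \<beta> k = a_block \<alpha> \<beta> k \<otimes>\<^sub>k 1\<^sub>m m"

definition B_tilde :: "nat \<Rightarrow> (nat \<Rightarrow> complex) \<Rightarrow> (nat \<Rightarrow> complex) \<Rightarrow> nat \<Rightarrow> complex mat" where
  "B_tilde m \<alpha> \<beta> k = b_block \<alpha> \<beta> k \<otimes>\<^sub>k 1\<^sub>m m"

definition X_fadi :: "nat \<Rightarrow> (nat \<Rightarrow> complex) \<Rightarrow> (nat \<Rightarrow> complex) \<Rightarrow> nat \<Rightarrow> complex mat" where
  "X_fadi m \<alpha> \<beta> k = mat_diag k (\<lambda>i. - (\<alpha> (Suc i) + \<beta> (Suc i))) \<otimes>\<^sub>k 1\<^sub>m m"

definition stein_solution :: "complex mat \<Rightarrow> complex mat \<Rightarrow> complex mat \<Rightarrow> bool" where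
  "stein_solution A B P \<longleftrightarrow> P \<in> carrier_mat (dim_row A) (dim_row A) \<and>
     A * P * mat_adjoint A - P + B * mat_adjoint B = 0\<^sub>m (dim_row A) (dim_row A)"

definition controllability_gramian :: "complex mat \<Rightarrow> complex mat \<Rightarrow> complex mat" where
  "controllability_gramian A B = (THE P. stein_solution A B P)"

text \<open>
  \<open>t1 \<alpha> \<beta> S j i\<close> and \<open>t2 \<alpha> \<beta> S j\<close> are the entries \<open>[t\<^sub>1\<^sup>(\<^sup>j\<^sup>)]\<^sub>i\<close> and \<open>t\<^sub>2\<^sup>(\<^sup>j\<^sup>)\<close> of the last column
  of the \<open>j\<close>-th matrix, where \<open>S\<close> is the \<open>(j - 1)\<close>-th matrix.
\<close>

fun t1 :: "(nat \<Rightarrow> complex) \<Rightarrow> (nat \<Rightarrow> complex) \<Rightarrow> complex mat \<Rightarrow> nat \<Rightarrow> nat \<Rightarrow> complex" where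
  "t1 \<alpha> \<beta> S j i =
     (1 + (\<Sum>r\<in>{i..j - 1}. cnj (\<alpha> r + \<beta> r) * S $$ (i - 1, r - 1))
        - (\<Sum>r\<in>{1..<i}. (1 / \<beta> r - cnj (\<beta> r)) * t1 \<alpha> \<beta> S j r))
     / (1 / \<beta> i - cnj (\<beta> j))"

declare t1.simps [simp del]

definition t2 :: "(nat \<Rightarrow> complex) \<Rightarrow> (nat \<Rightarrow> complex) \<Rightarrow> complex mat \<Rightarrow> nat \<Rightarrow> complex" where
  "t2 \<alpha> \<beta> S j =
     (1 - (\<Sum>r\<in>{1..j - 1}. (1 / \<beta> r - cnj (\<beta> r)) * t1 \<alpha> \<beta> S j r))
     / (1 / \<beta> j - cnj (\<beta> j))"

fun T_block :: "(nat \<Rightarrow> complex) \<Rightarrow> (nat \<Rightarrow> complex) \<Rightarrow> nat \<Rightarrow> complex mat" where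
  "T_block \<alpha> \<beta> 0 = 0\<^sub>m 0 0"
| "T_block \<alpha> \<beta> (Suc 0) = scalar_mat (t2 \<alpha> \<beta> (T_block \<alpha> \<beta> 0) 1)"
| "T_block \<alpha> \<beta> (Suc (Suc n)) = (let j = Suc (Suc n); S = T_block \<alpha> \<beta> (Suc n) in
     four_block_mat S (mat (j - 1) 1 (\<lambda>(i, _). t1 \<alpha> \<beta> S j (Suc i)))
       (0\<^sub>m 1 (j - 1)) (scalar_mat (t2 \<alpha> \<beta> S j)))"

definition T_hat :: "nat \<Rightarrow> (nat \<Rightarrow> complex) \<Rightarrow> (nat \<Rightarrow> complex) \<Rightarrow> nat \<Rightarrow> complex mat" where
  "T_hat m \<alpha> \<beta> k = T_block \<alpha> \<beta> k \<otimes>\<^sub>k 1\<^sub>m m"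

definition Z_mat :: "nat \<Rightarrow> (nat \<Rightarrow> complex) \<Rightarrow> nat \<Rightarrow> complex mat" where
  "Z_mat m \<beta> k = mat_diag k (\<lambda>i. complex_of_real
     (sqrt ((1 - (cmod (\<beta> (Suc i)))\<^sup>2) / (\<Prod>j\<in>{1..Suc i}. (cmod (\<beta> j))\<^sup>2)))) \<otimes>\<^sub>k 1\<^sub>m m"

definition Z_tilde :: "nat \<Rightarrow> (nat \<Rightarrow> complex) \<Rightarrow> (nat \<Rightarrow> complex) \<Rightarrow> nat \<Rightarrow> complex mat" where
  "Z_tilde m \<alpha> \<beta> k = X_fadi m \<alpha> \<beta> k * mat_adjoint (T_hat m \<alpha> \<beta> k) * Z_mat m \<beta> k"

end

theory Submission
  imports Defs
begin

text \<open>
  The factor \<open>I\<^sub>m\<close> splits off from every matrix, so it is enough to treat \<open>m = 1\<close>. Write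
  \<open>d\<^sub>i = \<alpha>\<^sub>i + \<beta>\<^sub>i\<close>, let \<open>D\<close> be the diagonal matrix of the \<open>d\<^sub>i\<close>, \<open>u\<close> the column of ones, and
  \<open>M\<close> the lower triangular matrix with diagonal entries \<open>\<beta>\<^sub>i\<close> and entries \<open>d\<^sub>l\<close> at \<open>(i, l)\<close> for
  \<open>l < i\<close>. Then \<open>a D = D M\<close> and \<open>b = D u\<close>. With \<open>W = Z Z\<^sup>*\<close>, the product of the claimed factor with
  its adjoint is \<open>D Q D\<^sup>*\<close>, where \<open>Q = T\<^sup>* W T\<close>. Hence the Stein equation for it follows from
  \<open>M Q M\<^sup>* = Q - u u\<^sup>*\<close>, that is, from the following identity for any two columns \<open>x\<close>, \<open>y\<close> of \<open>T\<close>
  and the columns \<open>x'\<close>, \<open>y'\<close> of \<open>T M\<^sup>*\<close> with the same indices: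
  \<open>\<Sum>i. w\<^sub>i * cnj x'\<^sub>i * y'\<^sub>i = (\<Sum>i. w\<^sub>i * cnj x\<^sub>i * y\<^sub>i) - 1\<close>.

  The identity is the energy balance of a cascade. Feed a vector \<open>x\<close> into a chain of stages: the
  signal passed along the chain starts as \<open>s\<^sub>1 = -1\<close> and continues as
  \<open>s\<^sub>i\<^sub>+\<^sub>1 = s\<^sub>i + (1 / \<beta>\<^sub>i - cnj \<beta>\<^sub>i) * x\<^sub>i\<close>, while stage \<open>i\<close> puts out \<open>x\<^sub>i / \<beta>\<^sub>i + s\<^sub>i\<close>. The squared
  diagonal entries \<open>w\<^sub>i\<close> of \<open>Z\<close> are exactly the weights for which no stage loses energy, so the
  energies telescope (\<open>lossless_cascade\<close>). Solved for their numerators, the recursions defining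
  \<open>T\<close> say two things: column \<open>p\<close> of \<open>T\<close>, taken as input, has column \<open>p\<close> of \<open>T M\<^sup>*\<close> as output
  (\<open>through_output_T_column\<close>), and the signal is 0 at the end of the chain
  (\<open>through_signal_T_column\<close>). The \<open>-1\<close> in the identity thus accounts for the energy of the initial
  signal.

  Uniqueness needs only that the coefficient matrix is triangular with diagonal entries in the open
  unit disc: the entries of a solution of the homogeneous equation vanish one after the other, from
  the upper left corner on (\<open>stein_homogeneous_zero\<close>).
\<close>

section \<open>Adjoints and Kronecker products\<close>

lemma dim_mat_adjoint [simp]:
  fixes A :: "complex mat"
  shows "dim_row (mat_adjoint A) = dim_col A" "dim_col (mat_adjoint A) = dim_row A"
  unfolding mat_adjoint_def by auto

lemma mat_adjoint_carrier [simp, intro]: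
  fixes A :: "complex mat"
  shows "A \<in> carrier_mat n m \<Longrightarrow> mat_adjoint A \<in> carrier_mat m n"
  by (intro carrier_matI) auto

lemma index_mat_adjoint [simp]:
  fixes A :: "complex mat"
  assumes "i < dim_col A" "j < dim_row A"
  shows "mat_adjoint A $$ (i, j) = cnj (A $$ (j, i))"
  using assms unfolding mat_adjoint_def by (subst mat_of_rows_index) auto

lemma index_mult_mat_sum:
  assumes "i < dim_row A" "j < dim_col B" "dim_col A = dim_row B"
  shows "(A * B) $$ (i, j) = (\<Sum>l<dim_row B. A $$ (i, l) * B $$ (l, j))"
  using assms by (simp add: scalar_prod_def lessThan_atLeast0)

lemma mat_adjoint_mult:
  fixes A B :: "complex mat"
  assumes "dim_col A = dim_row B"
  shows "mat_adjoint (A * B) = mat_adjoint B * mat_adjoint A"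
proof (rule eq_matI)
  fix i j assume "i < dim_row (mat_adjoint B * mat_adjoint A)" "j < dim_col (mat_adjoint B * mat_adjoint A)"
  then have i: "i < dim_col B" and j: "j < dim_row A" by auto
  then show "mat_adjoint (A * B) $$ (i, j) = (mat_adjoint B * mat_adjoint A) $$ (i, j)"
    using assms by (simp add: index_mult_mat_sum mult.commute del: index_mult_mat(1))
qed auto

lemma kronecker_dims [simp]:
  "dim_row (A \<otimes>\<^sub>k B) = dim_row A * dim_row B" "dim_col (A \<otimes>\<^sub>k B) = dim_col A * dim_col B"
  unfolding kronecker_def by auto

lemma div_mod_less:
  fixes i n m :: nat
  assumes "i < n * m"
  shows "i div m < n" "i mod m < m"
proof -
  have "m > 0" using assms by (cases m) auto
  then show "i div m < n" "i mod m < m"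
    using assms by (auto simp: less_mult_imp_div_less)
qed

lemma index_kronecker:
  assumes "i < dim_row A * dim_row B" "j < dim_col A * dim_col B"
  shows "(A \<otimes>\<^sub>k B) $$ (i, j) =
    A $$ (i div dim_row B, j div dim_col B) * B $$ (i mod dim_row B, j mod dim_col B)"
  using assms unfolding kronecker_def by simp

text \<open>
  A Kronecker product numbers its index pairs \<open>(a, b)\<close> as \<open>a * m + b\<close>, so sums over its index set
  are double sums.
\<close>

lemma sum_div_mod:
  fixes f :: "nat \<Rightarrow> nat \<Rightarrow> 'a :: comm_monoid_add"
  shows "(\<Sum>l<n * m. f (l div m) (l mod m)) = (\<Sum>a<n. \<Sum>b<m. f a b)"
proof -
  have "(\<Sum>l<n * m. f (l div m) (l mod m)) = (\<Sum>a<n. \<Sum>l\<in>{a * m..<a * m + m}. f (l div m) (l mod m))"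
    by (rule sum.nat_group [symmetric])
  also have "\<dots> = (\<Sum>a<n. \<Sum>b<m. f a b)"
  proof (rule sum.cong[OF refl])
    fix a
    have "(\<Sum>l\<in>{a * m..<a * m + m}. f (l div m) (l mod m))
        = (\<Sum>b\<in>{0..<m}. f ((b + a * m) div m) ((b + a * m) mod m))"
      using sum.shift_bounds_nat_ivl[of "\<lambda>l. f (l div m) (l mod m)" 0 "a * m" m]
      by (simp add: add.commute)
    also have "\<dots> = (\<Sum>b<m. f a b)"
      by (auto simp: lessThan_atLeast0 intro!: sum.cong)
    finally show "(\<Sum>l\<in>{a * m..<a * m + m}. f (l div m) (l mod m)) = (\<Sum>b<m. f a b)" .
  qed
  finally show ?thesis .
qed

lemma kronecker_mult:
  assumes "dim_col A = dim_row C" "dim_col B = dim_row D"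
  shows "(A \<otimes>\<^sub>k B) * (C \<otimes>\<^sub>k D) = (A * C) \<otimes>\<^sub>k (B * D)"
proof (rule eq_matI)
  fix i j
  assume "i < dim_row ((A * C) \<otimes>\<^sub>k (B * D))" "j < dim_col ((A * C) \<otimes>\<^sub>k (B * D))"
  then have i: "i < dim_row A * dim_row B" and j: "j < dim_col C * dim_col D" by auto
  let ?i = "i div dim_row B" and ?i' = "i mod dim_row B"
  let ?j = "j div dim_col D" and ?j' = "j mod dim_col D"
  have "((A \<otimes>\<^sub>k B) * (C \<otimes>\<^sub>k D)) $$ (i, j)
      = (\<Sum>l<dim_row C * dim_row D. (A \<otimes>\<^sub>k B) $$ (i, l) * (C \<otimes>\<^sub>k D) $$ (l, j))"
    using i j assms by (subst index_mult_mat_sum) auto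
  also have "\<dots> = (\<Sum>l<dim_row C * dim_row D.
      (A $$ (?i, l div dim_row D) * B $$ (?i', l mod dim_row D)) *
      (C $$ (l div dim_row D, ?j) * D $$ (l mod dim_row D, ?j')))"
    using i j assms by (intro sum.cong) (auto simp: index_kronecker)
  also have "\<dots> = (\<Sum>a<dim_row C. \<Sum>b<dim_row D.
      (A $$ (?i, a) * B $$ (?i', b)) * (C $$ (a, ?j) * D $$ (b, ?j')))"
    by (rule sum_div_mod)
  also have "\<dots> = (\<Sum>a<dim_row C. A $$ (?i, a) * C $$ (a, ?j)) * (\<Sum>b<dim_row D. B $$ (?i', b) * D $$ (b, ?j'))"
    by (simp add: sum_product algebra_simps)
  also have "\<dots> = ((A * C) \<otimes>\<^sub>k (B * D)) $$ (i, j)"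
    using i j assms div_mod_less[OF i] div_mod_less[OF j]
    by (simp add: index_kronecker index_mult_mat_sum del: index_mult_mat(1))
  finally show "((A \<otimes>\<^sub>k B) * (C \<otimes>\<^sub>k D)) $$ (i, j) = ((A * C) \<otimes>\<^sub>k (B * D)) $$ (i, j)" .
qed auto

lemma mat_adjoint_kronecker: "mat_adjoint (A \<otimes>\<^sub>k B) = mat_adjoint A \<otimes>\<^sub>k mat_adjoint B"
proof (rule eq_matI)
  fix i j assume "i < dim_row (mat_adjoint A \<otimes>\<^sub>k mat_adjoint B)" "j < dim_col (mat_adjoint A \<otimes>\<^sub>k mat_adjoint B)"
  then have i: "i < dim_col A * dim_col B" and j: "j < dim_row A * dim_row B" by auto
  then show "(mat_adjoint (A \<otimes>\<^sub>k B)) $$ (i, j) = (mat_adjoint A \<otimes>\<^sub>k mat_adjoint B) $$ (i, j)"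
    using div_mod_less[OF i] div_mod_less[OF j] by (simp add: index_kronecker algebra_simps)
qed auto

lemma mat_adjoint_one [simp]: "mat_adjoint (1\<^sub>m n :: complex mat) = 1\<^sub>m n"
  by (intro eq_matI) auto

lemma kronecker_add_left:
  assumes "dim_row A = dim_row A'" "dim_col A = dim_col A'"
  shows "(A + A') \<otimes>\<^sub>k B = A \<otimes>\<^sub>k B + A' \<otimes>\<^sub>k B"
proof (rule eq_matI)
  fix i j assume "i < dim_row (A \<otimes>\<^sub>k B + A' \<otimes>\<^sub>k B)" "j < dim_col (A \<otimes>\<^sub>k B + A' \<otimes>\<^sub>k B)"
  then have i: "i < dim_row A * dim_row B" and j: "j < dim_col A * dim_col B" using assms by auto
  then show "((A + A') \<otimes>\<^sub>k B) $$ (i, j) = (A \<otimes>\<^sub>k B + A' \<otimes>\<^sub>k B) $$ (i, j)"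
    using assms div_mod_less[OF i] div_mod_less[OF j] by (simp add: index_kronecker algebra_simps)
qed (use assms in auto)

lemma kronecker_diff_left:
  assumes "dim_row A = dim_row A'" "dim_col A = dim_col A'"
  shows "(A - A') \<otimes>\<^sub>k B = A \<otimes>\<^sub>k B - A' \<otimes>\<^sub>k B"
proof (rule eq_matI)
  fix i j assume "i < dim_row (A \<otimes>\<^sub>k B - A' \<otimes>\<^sub>k B)" "j < dim_col (A \<otimes>\<^sub>k B - A' \<otimes>\<^sub>k B)"
  then have i: "i < dim_row A * dim_row B" and j: "j < dim_col A * dim_col B" using assms by auto
  then show "((A - A') \<otimes>\<^sub>k B) $$ (i, j) = (A \<otimes>\<^sub>k B - A' \<otimes>\<^sub>k B) $$ (i, j)"
    using assms div_mod_less[OF i] div_mod_less[OF j] by (simp add: index_kronecker algebra_simps)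
qed (use assms in auto)

lemma kronecker_zero_left: "0\<^sub>m r c \<otimes>\<^sub>k B = 0\<^sub>m (r * dim_row B) (c * dim_col B)"
proof (rule eq_matI)
  fix i j assume "i < dim_row (0\<^sub>m (r * dim_row B) (c * dim_col B))" "j < dim_col (0\<^sub>m (r * dim_row B) (c * dim_col B))"
  then have i: "i < r * dim_row B" and j: "j < c * dim_col B" by auto
  then show "(0\<^sub>m r c \<otimes>\<^sub>k B) $$ (i, j) = (0\<^sub>m (r * dim_row B) (c * dim_col B)) $$ (i, j)"
    using div_mod_less[OF i] div_mod_less[OF j] by (simp add: index_kronecker algebra_simps)
qed auto

section \<open>Stein equations\<close>

text \<open>
  Every term of the Stein equation commutes with the Kronecker product by an identity matrix. This
  reduces existence to the case of scalar blocks.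
\<close>

lemma stein_solution_kronecker_one:
  assumes "dim_col A = dim_row A" "dim_row B = dim_row A" "stein_solution A B P"
  shows "stein_solution (A \<otimes>\<^sub>k 1\<^sub>m m) (B \<otimes>\<^sub>k 1\<^sub>m m) (P \<otimes>\<^sub>k 1\<^sub>m m)"
proof -
  have P: "dim_row P = dim_row A" "dim_col P = dim_row A"
    and eq: "A * P * mat_adjoint A - P + B * mat_adjoint B = 0\<^sub>m (dim_row A) (dim_row A)"
    using assms(3) unfolding stein_solution_def by auto
  have "(A \<otimes>\<^sub>k 1\<^sub>m m) * (P \<otimes>\<^sub>k 1\<^sub>m m) * mat_adjoint (A \<otimes>\<^sub>k 1\<^sub>m m) - P \<otimes>\<^sub>k 1\<^sub>m m
      + (B \<otimes>\<^sub>k 1\<^sub>m m) * mat_adjoint (B \<otimes>\<^sub>k 1\<^sub>m m)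
      = (A * P * mat_adjoint A - P + B * mat_adjoint B) \<otimes>\<^sub>k 1\<^sub>m m"
    using assms P
    by (simp add: mat_adjoint_kronecker kronecker_mult kronecker_add_left kronecker_diff_left)
  then show ?thesis
    unfolding stein_solution_def by (auto simp: eq kronecker_zero_left P intro!: carrier_matI)
qed

lemma norm_product_less_one:
  fixes b c :: complex
  assumes "cmod b < 1" "cmod c < 1"
  shows "cmod b * cmod c < 1"
  using assms mult_left_le[of "cmod c" "cmod b"] by simp

text \<open>
  Since \<open>A\<close> is lower triangular, entry \<open>(i, j)\<close> of \<open>A D A\<^sup>*\<close> involves only entries of \<open>D\<close> weakly
  above and to the left of \<open>(i, j)\<close>. Once the others vanish, the equation reduces to
  \<open>D\<^sub>i\<^sub>j = A\<^sub>i\<^sub>i * cnj A\<^sub>j\<^sub>j * D\<^sub>i\<^sub>j\<close>, whose factor has modulus less than 1. The induction is therefore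
  on \<open>i + j\<close>.
\<close>

lemma stein_homogeneous_zero:
  fixes A D :: "complex mat"
  assumes A: "A \<in> carrier_mat n n" and D: "D \<in> carrier_mat n n"
    and lower: "\<And>i j. i < j \<Longrightarrow> j < n \<Longrightarrow> A $$ (i, j) = 0"
    and diag: "\<And>i. i < n \<Longrightarrow> cmod (A $$ (i, i)) < 1"
    and eq: "A * D * mat_adjoint A = D"
  shows "D = 0\<^sub>m n n"
proof -
  have entry: "D $$ (i, j) = (\<Sum>s<n. (\<Sum>r<n. A $$ (i, r) * D $$ (r, s)) * cnj (A $$ (j, s)))"
    if "i < n" "j < n" for i j
    using that A D by (subst eq [symmetric])
      (simp add: index_mult_mat_sum del: index_mult_mat(1))
  have "D $$ (i, j) = 0" if "i < n" "j < n" for i j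
    using that
  proof (induction "i + j" arbitrary: i j rule: less_induct)
    case less
    \<comment> \<open>Only the corner term \<open>r = i\<close>, \<open>s = j\<close> survives.\<close>
    have inner: "(\<Sum>r<n. A $$ (i, r) * D $$ (r, s)) * cnj (A $$ (j, s))
        = (if s = j then A $$ (i, i) * D $$ (i, j) * cnj (A $$ (j, j)) else 0)" if "s < n" for s
    proof (cases "s \<le> j")
      case True
      have "A $$ (i, r) * D $$ (r, s) = (if r = i \<and> s = j then A $$ (i, i) * D $$ (i, j) else 0)"
        if "r < n" for r
      proof (cases "r \<le> i")
        case r: True
        show ?thesis
        proof (cases "r = i \<and> s = j")
          case False
          then have "r + s < i + j" using r True by auto
          then have "D $$ (r, s) = 0" using less.hyps that \<open>s < n\<close> by blast
          then show ?thesis using False by auto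
        qed auto
      qed (use lower that in auto)
      then have "(\<Sum>r<n. A $$ (i, r) * D $$ (r, s))
          = (\<Sum>r<n. if r = i then (if s = j then A $$ (i, i) * D $$ (i, j) else 0) else 0)"
        by (intro sum.cong) auto
      then show ?thesis using less.prems by (simp add: sum.delta)
    qed (use lower that in auto)
    have "D $$ (i, j) = (\<Sum>s<n. (\<Sum>r<n. A $$ (i, r) * D $$ (r, s)) * cnj (A $$ (j, s)))"
      using less.prems by (rule entry)
    also have "\<dots> = (\<Sum>s<n. if s = j then A $$ (i, i) * D $$ (i, j) * cnj (A $$ (j, j)) else 0)"
      using inner by (intro sum.cong) auto
    also have "\<dots> = A $$ (i, i) * D $$ (i, j) * cnj (A $$ (j, j))"
      using less.prems by simp
    finally have "D $$ (i, j) = A $$ (i, i) * D $$ (i, j) * cnj (A $$ (j, j))" .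
    then have "cmod (D $$ (i, j)) = cmod (A $$ (i, i)) * cmod (A $$ (j, j)) * cmod (D $$ (i, j))"
      by (metis (no_types) complex_mod_cnj mult.commute mult.assoc norm_mult)
    moreover have "cmod (A $$ (i, i)) * cmod (A $$ (j, j)) < 1"
      using diag less.prems by (intro norm_product_less_one)
    ultimately show ?case by (metis mult_cancel_right1 norm_eq_zero order_less_irrefl)
  qed
  then show ?thesis using D by (intro eq_matI) auto
qed

lemma stein_solution_unique:
  fixes A B P Q :: "complex mat"
  assumes A: "A \<in> carrier_mat n n" and B: "dim_row B = n"
    and lower: "\<And>i j. i < j \<Longrightarrow> j < n \<Longrightarrow> A $$ (i, j) = 0"
    and diag: "\<And>i. i < n \<Longrightarrow> cmod (A $$ (i, i)) < 1"
    and P: "stein_solution A B P" and Q: "stein_solution A B Q"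
  shows "P = Q"
proof -
  have PQ: "P \<in> carrier_mat n n" "Q \<in> carrier_mat n n"
    using P Q A B unfolding stein_solution_def by auto
  have AP: "A * R \<in> carrier_mat n n" "A * R * mat_adjoint A \<in> carrier_mat n n"
    if "R \<in> carrier_mat n n" for R using that A by auto
  have "A * (P - Q) * mat_adjoint A = A * P * mat_adjoint A - A * Q * mat_adjoint A"
    using A PQ AP
    by (simp add: mult_minus_distrib_mat[of _ n n _ n] minus_mult_distrib_mat[of _ n n _ _ n])
  also have "\<dots> = P - Q"
  proof (rule eq_matI)
    fix i j assume "i < dim_row (P - Q)" "j < dim_col (P - Q)"
    then have ij: "i < n" "j < n" using PQ by auto
    have e: "(A * R * mat_adjoint A) $$ (i, j) = R $$ (i, j) - (B * mat_adjoint B) $$ (i, j)"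
      if "stein_solution A B R" for R
    proof -
      have "(A * R * mat_adjoint A - R + B * mat_adjoint B) $$ (i, j) = 0" and R: "R \<in> carrier_mat n n"
        using that A ij unfolding stein_solution_def by auto
      then have "(A * R * mat_adjoint A) $$ (i, j) - R $$ (i, j) + (B * mat_adjoint B) $$ (i, j) = 0"
        using ij A B R by (simp del: index_mult_mat(1))
      then show ?thesis by (simp add: algebra_simps)
    qed
    show "(A * P * mat_adjoint A - A * Q * mat_adjoint A) $$ (i, j) = (P - Q) $$ (i, j)"
      using ij PQ AP e[OF P] e[OF Q] A by (simp del: index_mult_mat(1))
  qed (use PQ A in auto)
  finally have "P - Q = 0\<^sub>m n n"
    using PQ A lower diag by (intro stein_homogeneous_zero[of A n "P - Q"]) (auto intro: minus_carrier_mat)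
  then have "(P - Q) $$ (i, j) = 0" if "i < n" "j < n" for i j using that by simp
  then show ?thesis using PQ by (intro eq_matI) auto
qed

section \<open>Energy balance of a lossless cascade\<close>

definition energy_weight :: "(nat \<Rightarrow> complex) \<Rightarrow> nat \<Rightarrow> real" where
  "energy_weight \<beta> i = (1 - (cmod (\<beta> (Suc i)))\<^sup>2) / (\<Prod>j\<in>{1..Suc i}. (cmod (\<beta> j))\<^sup>2)"

text \<open>
  The signal entering stage \<open>i\<close> (counted from 0) of the cascade with input \<open>x\<close>. It starts at \<open>-1\<close>,
  which accounts for the constant 1 in the numerators of the recursions for \<open>T\<close>.
\<close>

definition through_signal :: "(nat \<Rightarrow> complex) \<Rightarrow> (nat \<Rightarrow> complex) \<Rightarrow> nat \<Rightarrow> complex" where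
  "through_signal \<beta> x i = (\<Sum>r<i. (1 / \<beta> (Suc r) - cnj (\<beta> (Suc r))) * x r) - 1"

text \<open>
  The weight \<open>(1 - \<bar>b\<bar>\<^sup>2) / (p \<bar>b\<bar>\<^sup>2)\<close> is the difference of \<open>1 / (p \<bar>b\<bar>\<^sup>2)\<close> and \<open>1 / p\<close>, the weights
  of the signal behind and before the stage; with these weights the map
  \<open>(x, s) \<mapsto> (x / b + s, s + (1 / b - cnj b) * x)\<close> conserves energy. Here \<open>p\<close> is the product of the
  \<open>\<bar>\<beta>\<^sub>j\<bar>\<^sup>2\<close> over the earlier stages. The bilinear form of the balance is needed for the
  off-diagonal entries of the Gramian.
\<close>

lemma lossless_stage:
  fixes b p x y s t :: complex
  assumes "b \<noteq> 0" "p \<noteq> 0"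
  shows "(1 - b * cnj b) / (p * (b * cnj b)) * (cnj (x / b + s) * (y / b + t))
    = (1 - b * cnj b) / (p * (b * cnj b)) * (cnj x * y)
      + cnj (s + (1 / b - cnj b) * x) * (t + (1 / b - cnj b) * y) / (p * (b * cnj b))
      - cnj s * t / p"
  using assms by (simp add: field_simps)

text \<open>
  The energies of the signals between consecutive stages telescope; the \<open>-1\<close> is the contribution of
  the initial signal, whose weight is the empty product.
\<close>

lemma lossless_cascade:
  assumes "\<And>i. i < n \<Longrightarrow> \<beta> (Suc i) \<noteq> 0"
  shows "(\<Sum>i<n. of_real (energy_weight \<beta> i) *
      (cnj (x i / \<beta> (Suc i) + through_signal \<beta> x i) * (y i / \<beta> (Suc i) + through_signal \<beta> y i)))
    = (\<Sum>i<n. of_real (energy_weight \<beta> i) * (cnj (x i) * y i))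
      + cnj (through_signal \<beta> x n) * through_signal \<beta> y n / of_real (\<Prod>j\<in>{1..n}. (cmod (\<beta> j))\<^sup>2) - 1"
  using assms
proof (induction n)
  case 0
  then show ?case by (simp add: through_signal_def)
next
  case (Suc n)
  let ?p = "complex_of_real (\<Prod>j\<in>{1..n}. (cmod (\<beta> j))\<^sup>2)" and ?b = "\<beta> (Suc n)"
  have b: "?b \<noteq> 0" using Suc.prems by simp
  have "\<beta> j \<noteq> 0" if "j \<in> {1..n}" for j
    using Suc.prems[of "j - 1"] that by (cases j) auto
  then have p: "?p \<noteq> 0" by (simp add: prod_zero_iff)
  have sq: "complex_of_real ((cmod ?b)\<^sup>2) = ?b * cnj ?b"
    by (rule complex_norm_square)
  have prod: "complex_of_real (\<Prod>j\<in>{1..Suc n}. (cmod (\<beta> j))\<^sup>2) = ?p * (?b * cnj ?b)"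
    using sq by (simp add: prod.nat_ivl_Suc')
  have w: "complex_of_real (energy_weight \<beta> n) = (1 - ?b * cnj ?b) / (?p * (?b * cnj ?b))"
    unfolding energy_weight_def of_real_divide prod of_real_diff sq by simp
  have step: "through_signal \<beta> z (Suc n) = through_signal \<beta> z n + (1 / ?b - cnj ?b) * z n" for z
    by (simp add: through_signal_def)
  have IH: "(\<Sum>i<n. of_real (energy_weight \<beta> i) *
      (cnj (x i / \<beta> (Suc i) + through_signal \<beta> x i) * (y i / \<beta> (Suc i) + through_signal \<beta> y i)))
    = (\<Sum>i<n. of_real (energy_weight \<beta> i) * (cnj (x i) * y i))
      + cnj (through_signal \<beta> x n) * through_signal \<beta> y n / ?p - 1"
    by (rule Suc.IH) (simp add: Suc.prems)
  have telescope: "(a + d - 1) + (c + e - d) = (a + c) + e - 1" for a c d e :: complex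
    by simp
  show ?case
    unfolding sum.lessThan_Suc IH prod step w lossless_stage[OF b p] by (rule telescope)
qed

section \<open>Entries of the block matrices\<close>

lemma a_block_Suc:
  "a_block \<alpha> \<beta> (Suc n) = four_block_mat (a_block \<alpha> \<beta> n) (0\<^sub>m n 1)
     ((\<alpha> (Suc n) + \<beta> (Suc n)) \<cdot>\<^sub>m transpose_mat (ones_col n)) (scalar_mat (\<beta> (Suc n)))"
  by (cases n) (auto simp: Let_def scalar_mat_def ones_col_def intro!: eq_matI)

lemma b_block_Suc:
  "b_block \<alpha> \<beta> (Suc n) = b_block \<alpha> \<beta> n @\<^sub>r scalar_mat (\<alpha> (Suc n) + \<beta> (Suc n))"
  by (cases n) (auto simp: Let_def scalar_mat_def append_rows_def intro!: eq_matI)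

lemma T_block_Suc:
  "T_block \<alpha> \<beta> (Suc n) = four_block_mat (T_block \<alpha> \<beta> n)
     (mat n 1 (\<lambda>(i, _). t1 \<alpha> \<beta> (T_block \<alpha> \<beta> n) (Suc n) (Suc i)))
     (0\<^sub>m 1 n) (scalar_mat (t2 \<alpha> \<beta> (T_block \<alpha> \<beta> n) (Suc n)))"
  by (cases n) (auto simp: Let_def scalar_mat_def intro!: eq_matI)

lemma a_block_eq:
  "a_block \<alpha> \<beta> k = mat k k (\<lambda>(i, l). if l < i then \<alpha> (Suc i) + \<beta> (Suc i)
     else if l = i then \<beta> (Suc i) else 0)"
proof (induction k)
  case (Suc k)
  show ?case
    unfolding a_block_Suc Suc.IH
    by (intro eq_matI) (auto simp: scalar_mat_def ones_col_def less_Suc_eq)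
qed auto

lemma b_block_eq: "b_block \<alpha> \<beta> k = mat k 1 (\<lambda>(i, _). \<alpha> (Suc i) + \<beta> (Suc i))"
proof (induction k)
  case (Suc k)
  show ?case
    unfolding b_block_Suc Suc.IH
    by (intro eq_matI) (auto simp: scalar_mat_def append_rows_def less_Suc_eq)
qed auto

text \<open>
  Later matrices of the family keep the columns of earlier ones, so column \<open>j\<close> may be read off from
  the first matrix that contains it. The entries then do not depend on the order \<open>k\<close>.
\<close>

definition T_entry :: "(nat \<Rightarrow> complex) \<Rightarrow> (nat \<Rightarrow> complex) \<Rightarrow> nat \<Rightarrow> nat \<Rightarrow> complex" where
  "T_entry \<alpha> \<beta> i j = (if i \<le> j then T_block \<alpha> \<beta> (Suc j) $$ (i, j) else 0)"

lemma T_block_eq: "T_block \<alpha> \<beta> k = mat k k (\<lambda>(i, j). T_entry \<alpha> \<beta> i j)"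
proof (induction k)
  case (Suc k)
  have dims: "dim_row (T_block \<alpha> \<beta> k) = k" "dim_col (T_block \<alpha> \<beta> k) = k"
    unfolding Suc.IH by auto
  show ?case
  proof (rule eq_matI)
    fix i j
    assume "i < dim_row (mat (Suc k) (Suc k) (\<lambda>(i, j). T_entry \<alpha> \<beta> i j))"
      and "j < dim_col (mat (Suc k) (Suc k) (\<lambda>(i, j). T_entry \<alpha> \<beta> i j))"
    then have ij: "i < Suc k" "j < Suc k" by auto
    show "T_block \<alpha> \<beta> (Suc k) $$ (i, j) = mat (Suc k) (Suc k) (\<lambda>(i, j). T_entry \<alpha> \<beta> i j) $$ (i, j)"
    proof (cases "j = k")
      case True
      then show ?thesis using ij by (simp add: T_entry_def)
    next
      case False
      then have j: "j < k" using ij by simp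
      have "T_block \<alpha> \<beta> (Suc k) $$ (i, j) = (if i < k then T_block \<alpha> \<beta> k $$ (i, j) else 0)"
        unfolding T_block_Suc using ij j dims by (simp add: scalar_mat_def)
      also have "\<dots> = T_entry \<alpha> \<beta> i j"
        using j ij by (auto simp: Suc.IH T_entry_def)
      finally show ?thesis using ij by simp
    qed
  qed (simp_all add: T_block_Suc dims scalar_mat_def)
qed auto

lemma T_entry_t1: "i < j \<Longrightarrow> T_entry \<alpha> \<beta> i j = t1 \<alpha> \<beta> (T_block \<alpha> \<beta> j) (Suc j) (Suc i)"
  unfolding T_entry_def T_block_Suc by (simp add: T_block_eq[of _ _ j] scalar_mat_def)

lemma T_entry_t2: "T_entry \<alpha> \<beta> j j = t2 \<alpha> \<beta> (T_block \<alpha> \<beta> j) (Suc j)"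
  unfolding T_entry_def T_block_Suc by (simp add: T_block_eq[of _ _ j] scalar_mat_def)

lemma T_entry_below: "j < i \<Longrightarrow> T_entry \<alpha> \<beta> i j = 0"
  by (simp add: T_entry_def)

text \<open>
  The two recursions are the cases \<open>i < j\<close> and \<open>i = j\<close> of one formula: by triangularity the sum over
  row \<open>i\<close> may start at column 0, and for \<open>i = j\<close> all its terms are zero.
\<close>

lemma T_entry_mult:
  assumes "i \<le> j" and den: "1 / \<beta> (Suc i) - cnj (\<beta> (Suc j)) \<noteq> 0"
  shows "T_entry \<alpha> \<beta> i j * (1 / \<beta> (Suc i) - cnj (\<beta> (Suc j)))
    = 1 + (\<Sum>l<j. cnj (\<alpha> (Suc l) + \<beta> (Suc l)) * T_entry \<alpha> \<beta> i l)
        - (\<Sum>r<i. (1 / \<beta> (Suc r) - cnj (\<beta> (Suc r))) * T_entry \<alpha> \<beta> r j)"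
proof -
  let ?S = "T_block \<alpha> \<beta> j"
  have shift: "(\<Sum>r\<in>{1..<Suc i}. f r) = (\<Sum>r<i. f (Suc r))" for f :: "nat \<Rightarrow> complex"
    using sum.shift_bounds_Suc_ivl[of f 0 i] by (simp add: lessThan_atLeast0)
  have col: "(\<Sum>r\<in>{1..<Suc i}. (1 / \<beta> r - cnj (\<beta> r)) * t1 \<alpha> \<beta> ?S (Suc j) r)
      = (\<Sum>r<i. (1 / \<beta> (Suc r) - cnj (\<beta> (Suc r))) * T_entry \<alpha> \<beta> r j)"
    unfolding shift using assms(1) by (intro sum.cong) (auto simp: T_entry_t1)
  show ?thesis
  proof (cases "i < j")
    case True
    have "(\<Sum>r\<in>{Suc i..Suc j - 1}. cnj (\<alpha> r + \<beta> r) * ?S $$ (Suc i - 1, r - 1))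
        = (\<Sum>l\<in>{i..<j}. cnj (\<alpha> (Suc l) + \<beta> (Suc l)) * T_entry \<alpha> \<beta> i l)"
    proof -
      have "(\<Sum>r\<in>{Suc i..<Suc j}. cnj (\<alpha> r + \<beta> r) * ?S $$ (i, r - 1))
          = (\<Sum>l\<in>{i..<j}. cnj (\<alpha> (Suc l) + \<beta> (Suc l)) * ?S $$ (i, Suc l - 1))"
        by (rule sum.shift_bounds_Suc_ivl)
      also have "\<dots> = (\<Sum>l\<in>{i..<j}. cnj (\<alpha> (Suc l) + \<beta> (Suc l)) * T_entry \<alpha> \<beta> i l)"
        unfolding T_block_eq[of _ _ j] using True by (intro sum.cong) auto
      finally show ?thesis by (simp only: atLeastLessThanSuc_atLeastAtMost diff_Suc_1)
    qed
    also have "\<dots> = (\<Sum>l<j. cnj (\<alpha> (Suc l) + \<beta> (Suc l)) * T_entry \<alpha> \<beta> i l)"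
      by (rule sum.mono_neutral_left) (auto simp: T_entry_below)
    finally show ?thesis
      using den col by (simp add: T_entry_t1[OF True] t1.simps[of _ _ _ _ "Suc i"])
  next
    case False
    then have "j = i" using assms(1) by simp
    moreover have "(\<Sum>l<i. cnj (\<alpha> (Suc l) + \<beta> (Suc l)) * T_entry \<alpha> \<beta> i l) = 0"
      by (intro sum.neutral) (auto simp: T_entry_below)
    ultimately show ?thesis
      using den col by (simp add: T_entry_t2 t2_def atLeastLessThanSuc_atLeastAtMost)
  qed
qed

section \<open>Factorisation of the Gramian\<close>

lemma one_div_minus_cnj_nonzero:
  fixes b c :: complex
  assumes "b \<noteq> 0" "cmod b < 1" "cmod c < 1"
  shows "1 / b - cnj c \<noteq> 0"
proof
  assume "1 / b - cnj c = 0"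
  then have "b * cnj c = 1" using assms(1) by (simp add: field_simps)
  then have "cmod b * cmod c = 1" by (metis complex_mod_cnj norm_mult norm_one)
  moreover have "cmod b * cmod c < 1" using assms(2,3) by (rule norm_product_less_one)
  ultimately show False by simp
qed

text \<open>
  The diagonal entry of column \<open>p\<close> is chosen such that the signal vanishes behind stage \<open>p\<close>. The zeros
  below the diagonal keep it at 0 from there on.
\<close>

lemma through_signal_T_column:
  assumes "\<beta> (Suc p) \<noteq> 0" "cmod (\<beta> (Suc p)) < 1" "p < i"
  shows "through_signal \<beta> (\<lambda>r. T_entry \<alpha> \<beta> r p) i = 0"
proof -
  let ?v = "\<lambda>r. 1 / \<beta> (Suc r) - cnj (\<beta> (Suc r))"
  have "(\<Sum>l<p. cnj (\<alpha> (Suc l) + \<beta> (Suc l)) * T_entry \<alpha> \<beta> p l) = 0"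
    by (intro sum.neutral) (auto simp: T_entry_below)
  then have "T_entry \<alpha> \<beta> p p * ?v p = 1 - (\<Sum>r<p. ?v r * T_entry \<alpha> \<beta> r p)"
    using T_entry_mult[of p p \<beta> \<alpha>] one_div_minus_cnj_nonzero[OF assms(1,2,2)] by simp
  then have "(\<Sum>r<Suc p. ?v r * T_entry \<alpha> \<beta> r p) = 1"
    by (simp add: mult.commute)
  also have "(\<Sum>r<Suc p. ?v r * T_entry \<alpha> \<beta> r p) = (\<Sum>r<i. ?v r * T_entry \<alpha> \<beta> r p)"
    using assms(3) by (intro sum.mono_neutral_left) (auto simp: T_entry_below)
  finally show ?thesis by (simp add: through_signal_def)
qed

text \<open>
  The right hand side is entry \<open>(i, p)\<close> of \<open>T M\<^sup>*\<close>. On and above the diagonal the equation is the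
  recursion for \<open>T\<close>; below, both sides vanish, the left one because the signal has died out.
\<close>

lemma through_output_T_column:
  assumes unit: "\<And>i. i < k \<Longrightarrow> cmod (\<beta> (Suc i)) < 1" and nz: "\<And>i. i < k \<Longrightarrow> \<beta> (Suc i) \<noteq> 0"
    and i: "i < k" and p: "p < k"
  shows "T_entry \<alpha> \<beta> i p / \<beta> (Suc i) + through_signal \<beta> (\<lambda>r. T_entry \<alpha> \<beta> r p) i
    = cnj (\<beta> (Suc p)) * T_entry \<alpha> \<beta> i p
      + (\<Sum>l<p. cnj (\<alpha> (Suc l) + \<beta> (Suc l)) * T_entry \<alpha> \<beta> i l)"
proof (cases "i \<le> p")
  case True
  show ?thesis
    using T_entry_mult[OF True one_div_minus_cnj_nonzero[OF nz[OF i] unit[OF i] unit[OF p]]]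
    by (simp only: through_signal_def right_diff_distrib) (simp add: algebra_simps)
next
  case False
  then have "(\<Sum>l<p. cnj (\<alpha> (Suc l) + \<beta> (Suc l)) * T_entry \<alpha> \<beta> i l) = 0"
    by (intro sum.neutral) (auto simp: T_entry_below)
  then show ?thesis
    using False through_signal_T_column[of \<beta>, OF nz[OF p] unit[OF p]] by (simp add: T_entry_below)
qed

definition gramian_factor :: "(nat \<Rightarrow> complex) \<Rightarrow> (nat \<Rightarrow> complex) \<Rightarrow> nat \<Rightarrow> complex mat" where
  "gramian_factor \<alpha> \<beta> k = mat k k (\<lambda>(p, i). - (\<alpha> (Suc p) + \<beta> (Suc p)) * cnj (T_entry \<alpha> \<beta> i p) *
     of_real (sqrt (energy_weight \<beta> i)))"

lemma Z_tilde_eq: "Z_tilde m \<alpha> \<beta> k = gramian_factor \<alpha> \<beta> k \<otimes>\<^sub>k 1\<^sub>m m"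
proof -
  let ?X = "mat_diag k (\<lambda>i. - (\<alpha> (Suc i) + \<beta> (Suc i)))" and ?T = "T_block \<alpha> \<beta> k"
  let ?Z = "mat_diag k (\<lambda>i. complex_of_real (sqrt (energy_weight \<beta> i)))"
  have T: "?T \<in> carrier_mat k k" by (subst T_block_eq) simp
  have diag: "dim_row (mat_diag k f) = k" "dim_col (mat_diag k f) = k" for f :: "nat \<Rightarrow> complex"
    unfolding mat_diag_def by auto
  have "Z_tilde m \<alpha> \<beta> k = (?X * mat_adjoint ?T * ?Z) \<otimes>\<^sub>k 1\<^sub>m m"
    using T unfolding Z_tilde_def X_fadi_def T_hat_def Z_mat_def energy_weight_def [symmetric]
    by (simp add: mat_adjoint_kronecker kronecker_mult diag)
  also have "?X * mat_adjoint ?T * ?Z = gramian_factor \<alpha> \<beta> k"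
  proof -
    have XT: "?X * mat_adjoint ?T = mat k k (\<lambda>(i, j). - (\<alpha> (Suc i) + \<beta> (Suc i)) * mat_adjoint ?T $$ (i, j))"
      using T by (intro mat_diag_mult_left) auto
    show ?thesis
      unfolding XT gramian_factor_def
      by (subst mat_diag_mult_right[of _ k], simp) (intro eq_matI, auto simp: T_block_eq[of _ _ k])
  qed
  finally show ?thesis .
qed

text \<open>
  This is \<open>a D T\<^sup>* = D (T M\<^sup>*)\<^sup>*\<close>: multiplying the factor by \<open>a\<close> replaces the columns of \<open>T\<close> by
  those of \<open>T M\<^sup>*\<close>.
\<close>

lemma index_a_block_mult_gramian_factor:
  assumes "p < k" "i < k"
  shows "(a_block \<alpha> \<beta> k * gramian_factor \<alpha> \<beta> k) $$ (p, i) = - (\<alpha> (Suc p) + \<beta> (Suc p)) *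
    cnj (cnj (\<beta> (Suc p)) * T_entry \<alpha> \<beta> i p
      + (\<Sum>l<p. cnj (\<alpha> (Suc l) + \<beta> (Suc l)) * T_entry \<alpha> \<beta> i l)) *
    of_real (sqrt (energy_weight \<beta> i))"
proof -
  let ?d = "\<lambda>i. \<alpha> (Suc i) + \<beta> (Suc i)" and ?z = "complex_of_real (sqrt (energy_weight \<beta> i))"
  let ?a = "\<lambda>l. if l < p then ?d p else if l = p then \<beta> (Suc p) else 0"
  let ?f = "\<lambda>l. ?a l * (- ?d l * cnj (T_entry \<alpha> \<beta> i l) * ?z)"
  have "(a_block \<alpha> \<beta> k * gramian_factor \<alpha> \<beta> k) $$ (p, i) = (\<Sum>l<k. ?f l)"
    using assms unfolding a_block_eq gramian_factor_def
    by (subst index_mult_mat_sum) (auto intro!: sum.cong)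
  also have "\<dots> = (\<Sum>l<Suc p. ?f l)"
    using assms by (intro sum.mono_neutral_right) auto
  also have "\<dots> = (\<Sum>l<p. ?d p * (- ?d l * cnj (T_entry \<alpha> \<beta> i l) * ?z)) + ?f p"
    by simp
  also have "(\<Sum>l<p. ?d p * (- ?d l * cnj (T_entry \<alpha> \<beta> i l) * ?z))
      = - ?d p * ?z * (\<Sum>l<p. ?d l * cnj (T_entry \<alpha> \<beta> i l))"
    unfolding sum_distrib_left by (intro sum.cong) (auto simp: algebra_simps)
  finally show ?thesis
    by (simp add: algebra_simps)
qed

text \<open>
  The scalar-block case of existence: each entry of the Stein equation is, up to the factor
  \<open>d\<^sub>p * cnj d\<^sub>q\<close>, the energy balance for the columns \<open>p\<close> and \<open>q\<close> of \<open>T\<close>.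
\<close>

lemma stein_solution_gramian_factor:
  assumes unit: "\<And>i. i < k \<Longrightarrow> cmod (\<beta> (Suc i)) < 1" and nz: "\<And>i. i < k \<Longrightarrow> \<beta> (Suc i) \<noteq> 0"
  shows "stein_solution (a_block \<alpha> \<beta> k) (b_block \<alpha> \<beta> k)
    (gramian_factor \<alpha> \<beta> k * mat_adjoint (gramian_factor \<alpha> \<beta> k))"
proof -
  let ?a = "a_block \<alpha> \<beta> k" and ?b = "b_block \<alpha> \<beta> k" and ?F = "gramian_factor \<alpha> \<beta> k"
  let ?d = "\<lambda>i. \<alpha> (Suc i) + \<beta> (Suc i)" and ?w = "energy_weight \<beta>"
  let ?T = "T_entry \<alpha> \<beta>"
  let ?Y = "\<lambda>i p. ?T i p / \<beta> (Suc i) + through_signal \<beta> (\<lambda>r. ?T r p) i"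
  have a: "?a \<in> carrier_mat k k" by (subst a_block_eq) simp
  have b: "?b \<in> carrier_mat k 1" by (subst b_block_eq) simp
  have F: "?F \<in> carrier_mat k k" by (simp add: gramian_factor_def)
  \<comment> \<open>The quotient under the root is nonnegative since \<open>\<bar>\<beta>\<^sub>i\<bar> \<le> 1\<close>.\<close>
  have w: "complex_of_real (sqrt (?w i)) * complex_of_real (sqrt (?w i)) = of_real (?w i)"
    if "i < k" for i
  proof -
    have "(cmod (\<beta> (Suc i)))\<^sup>2 \<le> 1" using unit[OF that] by (simp add: power_le_one)
    then have "0 \<le> ?w i"
      unfolding energy_weight_def by (intro divide_nonneg_nonneg prod_nonneg) auto
    then show ?thesis by (simp flip: of_real_mult)
  qed
  have outer: "(\<Sum>i<k. - ?d p * cnj (g i) * of_real (sqrt (?w i)) *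
        cnj (- ?d q * cnj (h i) * of_real (sqrt (?w i))))
      = ?d p * cnj (?d q) * (\<Sum>i<k. of_real (?w i) * (cnj (g i) * h i))" for p q g h
    unfolding sum_distrib_left
    by (intro sum.cong) (simp_all add: algebra_simps flip: w)
  have "?a * (?F * mat_adjoint ?F) * mat_adjoint ?a = (?a * ?F) * mat_adjoint (?a * ?F)"
    using a F by (simp add: mat_adjoint_mult assoc_mult_mat[of _ k k _ k _ k] mult_carrier_mat[of _ k k _ k])
  moreover have "((?a * ?F) * mat_adjoint (?a * ?F)) $$ (p, q)
      = (?F * mat_adjoint ?F) $$ (p, q) - (?b * mat_adjoint ?b) $$ (p, q)"
    if p: "p < k" and q: "q < k" for p q
  proof -
    have aF: "(?a * ?F) $$ (p, i) = - ?d p * cnj (?Y i p) * of_real (sqrt (?w i))"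
      if "p < k" "i < k" for p i
    proof -
      have "?Y i p = cnj (\<beta> (Suc p)) * ?T i p + (\<Sum>l<p. cnj (?d l) * ?T i l)"
        by (rule through_output_T_column) (use unit nz that in auto)
      then show ?thesis
        by (simp only: index_a_block_mult_gramian_factor[OF that])
    qed
    have "((?a * ?F) * mat_adjoint (?a * ?F)) $$ (p, q)
        = (\<Sum>i<k. (?a * ?F) $$ (p, i) * cnj ((?a * ?F) $$ (q, i)))"
      using a F p q by (subst index_mult_mat_sum) (auto simp del: index_mult_mat(1))
    also have "\<dots> = ?d p * cnj (?d q) * (\<Sum>i<k. of_real (?w i) * (cnj (?Y i p) * ?Y i q))"
      unfolding outer [symmetric] using p q by (intro sum.cong) (simp_all only: aF lessThan_iff)
    also have "(\<Sum>i<k. of_real (?w i) * (cnj (?Y i p) * ?Y i q))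
        = (\<Sum>i<k. of_real (?w i) * (cnj (?T i p) * ?T i q)) - 1"
      using through_signal_T_column[of \<beta>, OF nz[OF p] unit[OF p] p]
      by (subst lossless_cascade) (simp_all add: nz)
    also have "?d p * cnj (?d q) * \<dots>
        = ?d p * cnj (?d q) * (\<Sum>i<k. of_real (?w i) * (cnj (?T i p) * ?T i q)) - ?d p * cnj (?d q)"
      by (simp only: right_diff_distrib mult_1_right)
    also have "?d p * cnj (?d q) * (\<Sum>i<k. of_real (?w i) * (cnj (?T i p) * ?T i q))
        = (?F * mat_adjoint ?F) $$ (p, q)"
      unfolding outer [symmetric] using p q F
      by (subst index_mult_mat_sum) (auto simp: gramian_factor_def intro!: sum.cong)
    also have "?d p * cnj (?d q) = (?b * mat_adjoint ?b) $$ (p, q)"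
      using p q b by (subst index_mult_mat_sum) (auto simp: b_block_eq)
    finally show ?thesis .
  qed
  ultimately have "?a * (?F * mat_adjoint ?F) * mat_adjoint ?a - ?F * mat_adjoint ?F + ?b * mat_adjoint ?b
      = 0\<^sub>m k k"
    using a b F by (intro eq_matI) (simp_all del: index_mult_mat(1))
  then show ?thesis
    using a F unfolding stein_solution_def by (auto intro!: carrier_matI)
qed

theorem theorem2p2:
  fixes k m :: nat and \<alpha> \<beta> :: "nat \<Rightarrow> complex"
  assumes "k \<ge> 1" and "m \<ge> 1"
    and "\<And>i. i \<in> {1..k} \<Longrightarrow> \<alpha> i + \<beta> i \<noteq> 0"
    and "\<And>i. i \<in> {1..k} \<Longrightarrow> cmod (\<beta> i) < 1"
    and "\<And>i. i \<in> {1..k} \<Longrightarrow> \<beta> i \<noteq> 0"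
  shows "(\<exists>!P. stein_solution (A_tilde m \<alpha> \<beta> k) (B_tilde m \<alpha> \<beta> k) P) \<and>
    controllability_gramian (A_tilde m \<alpha> \<beta> k) (B_tilde m \<alpha> \<beta> k)
      = Z_tilde m \<alpha> \<beta> k * mat_adjoint (Z_tilde m \<alpha> \<beta> k)"
proof -
  let ?A = "A_tilde m \<alpha> \<beta> k" and ?B = "B_tilde m \<alpha> \<beta> k"
  let ?F = "gramian_factor \<alpha> \<beta> k" and ?Z = "Z_tilde m \<alpha> \<beta> k"
  have dims: "dim_row (a_block \<alpha> \<beta> k) = k" "dim_col (a_block \<alpha> \<beta> k) = k"
    "dim_row (b_block \<alpha> \<beta> k) = k"
    by (simp_all add: a_block_eq b_block_eq)
  have unit: "cmod (\<beta> (Suc i)) < 1" and nz: "\<beta> (Suc i) \<noteq> 0" if "i < k" for i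
    using assms(4,5)[of "Suc i"] that by auto
  have A: "?A \<in> carrier_mat (k * m) (k * m)" and B: "dim_row ?B = k * m"
    by (auto simp: A_tilde_def B_tilde_def dims intro!: carrier_matI)
  have "?Z * mat_adjoint ?Z = (?F * mat_adjoint ?F) \<otimes>\<^sub>k 1\<^sub>m m"
    unfolding Z_tilde_eq by (simp add: mat_adjoint_kronecker kronecker_mult)
  then have sol: "stein_solution ?A ?B (?Z * mat_adjoint ?Z)"
    unfolding A_tilde_def B_tilde_def
    by (auto intro!: stein_solution_kronecker_one stein_solution_gramian_factor simp: dims unit nz)
  have lower: "?A $$ (i, j) = 0" if "i < j" "j < k * m" for i j
  proof -
    have i: "i < k * m" using that by simp
    have "i div m \<noteq> j div m \<or> i mod m \<noteq> j mod m"
      using that by (metis div_mult_mod_eq less_irrefl)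
    moreover have "i div m \<le> j div m" using that by (intro div_le_mono) simp
    ultimately show ?thesis
      using that i div_mod_less[OF i] div_mod_less[OF that(2)]
      by (auto simp: A_tilde_def index_kronecker dims a_block_eq)
  qed
  have diag: "cmod (?A $$ (i, i)) < 1" if "i < k * m" for i
    using that div_mod_less[OF that] unit
    by (simp add: A_tilde_def index_kronecker dims) (simp add: a_block_eq)
  have uniq: "P = ?Z * mat_adjoint ?Z" if "stein_solution ?A ?B P" for P
    by (rule stein_solution_unique[OF A B _ _ that sol]) (simp_all add: lower diag)
  show ?thesis
    unfolding controllability_gramian_def
    by (intro conjI ex1I[of _ "?Z * mat_adjoint ?Z"] the_equality) (fact sol uniq)+
qed

end
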